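(* Let $(A,[\cdot,\cdot],\alpha)$ be a multiplicative Hom-Lie algebra, $(V,\rho,\beta)$ a representation of it, $\mathcal F$ a $2$-cocycle with respect to $(V,\rho,\beta)$, and $T:V\to A$ an $\mathcal F$-twisted $\mathcal O$-operator on $(A,[\cdot,\cdot],\alpha)$ with respect to $(V,\rho,\beta)$. Put $$[\![x,y,z]\!]_T=[[x,y],\alpha(z)],\quad \theta_\rho(x,y)=\rho(\alpha(y))\rho(x),\quad \mathcal G(x,y,z)=\mathcal F([x,y],\alpha(z))-\rho(\alpha(z))\mathcal F(x,y).$$ Then $T$ is an $(\mathcal F,\mathcal G)$-twisted $\mathcal O$-operator on the induced Hom-Lie-Yamaguti algebra $(A,[\cdot,\cdot],[\![\cdot,\cdot,\cdot]\!]_T,\alpha)$ with respect to the representation $(V,\rho,\theta_\rho,\beta)$.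
   Context: All linear spaces are finite-dimensional over a field $\mathbb K$ of characteristic $0$. $\circlearrowleft_{x,y,z}$ denotes the sum over cyclic permutations of $(x,y,z)$. Hom-Lie algebra $(A,[\cdot,\cdot],\alpha)$: bilinear skew-symmetric bracket, linear $\alpha:A\to A$, with $\circlearrowleft_{x,y,z}[\alpha(x),[y,z]]=0$; multiplicative if $\alpha([x,y])=[\alpha(x),\alpha(y)]$. A representation $(V,\rho,\beta)$: a linear space $V$, $\beta\in End(V)$, linear $\rho:A\to End(V)$ with $\rho(\alpha(x))\beta=\beta\rho(x)$ and $\rho([x,y])\beta=\rho(\alpha(x))\rho(y)-\rho(\alpha(y))\rho(x)$. A $2$-cocycle: a skew-symmetric bilinear $\mathcal F:A\times A\to V$ with $\mathcal F(\alpha(x),\alpha(y))=\beta\mathcal F(x,y)$ and $\circlearrowleft_{x,y,z}\big(\rho(\alpha(x))\mathcal F(y,z)+\mathcal F(\alpha(x),[y,z])\big)=0$. An $\mathcal F$-twisted $\mathcal O$-operator on a Hom-Lie algebra with respect to $(V,\rho,\beta)$ is a linear map $T:V\to A$ with $T\beta=\alpha T$ and $[Tu,Tv]=T\big(\rho(Tu)v-\rho(Tv)u+\mathcal F(Tu,Tv)\big)$ for all $u,v\in V$. For a multiplicative Hom-Lie algebra, $(A,[\cdot,\cdot],[\![\cdot,\cdot,\cdot]\!]_T,\alpha)$ is a Hom-Lie-Yamaguti algebra (the induced one), $(V,\rho,\theta_\rho,\beta)$ is a representation of it, and $(\mathcal F,\mathcal G)$ is a $(2,3)$-cocycle of it with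 coefficients in this representation. For a representation $(V,\rho,\theta,\beta)$ of a Hom-Lie-Yamaguti algebra $(A,[\cdot,\cdot],[\![\cdot,\cdot,\cdot]\!],\alpha)$ put $D(x,y)=\theta(y,x)-\theta(x,y)+\rho(\alpha(x))\rho(y)-\rho(\alpha(y))\rho(x)-\rho([x,y])\beta$. An $(\mathcal F,\mathcal G)$-twisted $\mathcal O$-operator on it with respect to $(V,\rho,\theta,\beta)$ is a linear map $T:V\to A$ such that for all $u,v,w\in V$: $T\beta=\alpha T$; $[Tu,Tv]=T\big(\rho(Tu)v-\rho(Tv)u+\mathcal F(Tu,Tv)\big)$; and $$[\![Tu,Tv,Tw]\!]=T\big(D(Tu,Tv)w+\theta(Tv,Tw)u-\theta(Tu,Tw)v+\mathcal G(Tu,Tv,Tw)\big).$$ *)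

theory Defs
  imports Complex_Main
begin

definition bilinear_map ::
  "('k::field \<Rightarrow> 'a::ab_group_add \<Rightarrow> 'a) \<Rightarrow> ('k \<Rightarrow> 'b::ab_group_add \<Rightarrow> 'b) \<Rightarrow>
   ('k \<Rightarrow> 'c::ab_group_add \<Rightarrow> 'c) \<Rightarrow> ('a \<Rightarrow> 'b \<Rightarrow> 'c) \<Rightarrow> bool"
where
  "bilinear_map s1 s2 s3 f \<longleftrightarrow>
     (\<forall>x. Vector_Spaces.linear s2 s3 (f x)) \<and>
     (\<forall>y. Vector_Spaces.linear s1 s3 (\<lambda>x. f x y))"

locale hom_lie_algebra =
  fixes sA :: "'k::field_char_0 \<Rightarrow> 'a::ab_group_add \<Rightarrow> 'a"
    and br :: "'a \<Rightarrow> 'a \<Rightarrow> 'a"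
    and \<alpha> :: "'a \<Rightarrow> 'a"
  assumes finite_dim_A: "\<exists>B. finite_dimensional_vector_space sA B"
    and bilinear_br: "bilinear_map sA sA sA br"
    and skew_br: "br x y = - br y x"
    and linear_alpha: "Vector_Spaces.linear sA sA \<alpha>"
    and hom_jacobi: "br (\<alpha> x) (br y z) + br (\<alpha> y) (br z x) + br (\<alpha> z) (br x y) = 0"

locale multiplicative_hom_lie_algebra = hom_lie_algebra +
  assumes multiplicative: "\<alpha> (br x y) = br (\<alpha> x) (\<alpha> y)"

text \<open>A linear map from \<open>A\<close> to \<open>End(V)\<close> is encoded in curried form, as a family of
  endomorphisms \<open>\<rho> x\<close> of \<open>V\<close> such that \<open>\<rho> x v\<close> is also linear in \<open>x\<close>.\<close>

locale hom_lie_representation = hom_lie_algebra sA br \<alpha>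
  for sA :: "'k::field_char_0 \<Rightarrow> 'a::ab_group_add \<Rightarrow> 'a"
    and br :: "'a \<Rightarrow> 'a \<Rightarrow> 'a"
    and \<alpha> :: "'a \<Rightarrow> 'a" +
  fixes sV :: "'k \<Rightarrow> 'v::ab_group_add \<Rightarrow> 'v"
    and \<rho> :: "'a \<Rightarrow> 'v \<Rightarrow> 'v"
    and \<beta> :: "'v \<Rightarrow> 'v"
  assumes finite_dim_V: "\<exists>B. finite_dimensional_vector_space sV B"
    and linear_beta: "Vector_Spaces.linear sV sV \<beta>"
    and linear_rho: "bilinear_map sA sV sV \<rho>"
    and rho_alpha: "\<rho> (\<alpha> x) \<circ> \<beta> = \<beta> \<circ> \<rho> x"
    and rho_br: "\<rho> (br x y) (\<beta> v) = \<rho> (\<alpha> x) (\<rho> y v) - \<rho> (\<alpha> y) (\<rho> x v)"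

locale hom_lie_2_cocycle = hom_lie_representation sA br \<alpha> sV \<rho> \<beta>
  for sA :: "'k::field_char_0 \<Rightarrow> 'a::ab_group_add \<Rightarrow> 'a"
    and br :: "'a \<Rightarrow> 'a \<Rightarrow> 'a"
    and \<alpha> :: "'a \<Rightarrow> 'a"
    and sV :: "'k \<Rightarrow> 'v::ab_group_add \<Rightarrow> 'v"
    and \<rho> :: "'a \<Rightarrow> 'v \<Rightarrow> 'v"
    and \<beta> :: "'v \<Rightarrow> 'v" +
  fixes F :: "'a \<Rightarrow> 'a \<Rightarrow> 'v"
  assumes bilinear_F: "bilinear_map sA sA sV F"
    and skew_F: "F x y = - F y x"
    and F_alpha: "F (\<alpha> x) (\<alpha> y) = \<beta> (F x y)"
    and F_cocycle:
      "(\<rho> (\<alpha> x) (F y z) + F (\<alpha> x) (br y z)) +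
       (\<rho> (\<alpha> y) (F z x) + F (\<alpha> y) (br z x)) +
       (\<rho> (\<alpha> z) (F x y) + F (\<alpha> z) (br x y)) = 0"

definition twisted_O_operator ::
  "('k::field_char_0 \<Rightarrow> 'a::ab_group_add \<Rightarrow> 'a) \<Rightarrow> ('a \<Rightarrow> 'a \<Rightarrow> 'a) \<Rightarrow> ('a \<Rightarrow> 'a) \<Rightarrow>
   ('k \<Rightarrow> 'v::ab_group_add \<Rightarrow> 'v) \<Rightarrow> ('a \<Rightarrow> 'v \<Rightarrow> 'v) \<Rightarrow> ('v \<Rightarrow> 'v) \<Rightarrow>
   ('a \<Rightarrow> 'a \<Rightarrow> 'v) \<Rightarrow> ('v \<Rightarrow> 'a) \<Rightarrow> bool"
where
  "twisted_O_operator sA br \<alpha> sV \<rho> \<beta> F T \<longleftrightarrow>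
     Vector_Spaces.linear sV sA T \<and>
     T \<circ> \<beta> = \<alpha> \<circ> T \<and>
     (\<forall>u v. br (T u) (T v) = T (\<rho> (T u) v - \<rho> (T v) u + F (T u) (T v)))"

definition hom_LY_D ::
  "('a \<Rightarrow> 'a \<Rightarrow> 'a) \<Rightarrow> ('a \<Rightarrow> 'a) \<Rightarrow> ('a \<Rightarrow> 'v \<Rightarrow> 'v) \<Rightarrow> ('a \<Rightarrow> 'a \<Rightarrow> 'v \<Rightarrow> 'v) \<Rightarrow> ('v \<Rightarrow> 'v) \<Rightarrow>
   'a \<Rightarrow> 'a \<Rightarrow> 'v::ab_group_add \<Rightarrow> 'v"
where
  "hom_LY_D br \<alpha> \<rho> \<theta> \<beta> x y v =
     \<theta> y x v - \<theta> x y v + \<rho> (\<alpha> x) (\<rho> y v) - \<rho> (\<alpha> y) (\<rho> x v) - \<rho> (br x y) (\<beta> v)"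

text \<open>Here \<open>tri\<close> is the ternary bracket of the Hom-Lie-Yamaguti algebra.\<close>

definition hom_LY_twisted_O_operator ::
  "('k::field_char_0 \<Rightarrow> 'a::ab_group_add \<Rightarrow> 'a) \<Rightarrow>
   ('a \<Rightarrow> 'a \<Rightarrow> 'a) \<Rightarrow> ('a \<Rightarrow> 'a \<Rightarrow> 'a \<Rightarrow> 'a) \<Rightarrow> ('a \<Rightarrow> 'a) \<Rightarrow>
   ('k \<Rightarrow> 'v::ab_group_add \<Rightarrow> 'v) \<Rightarrow>
   ('a \<Rightarrow> 'v \<Rightarrow> 'v) \<Rightarrow> ('a \<Rightarrow> 'a \<Rightarrow> 'v \<Rightarrow> 'v) \<Rightarrow> ('v \<Rightarrow> 'v) \<Rightarrow>
   ('a \<Rightarrow> 'a \<Rightarrow> 'v) \<Rightarrow> ('a \<Rightarrow> 'a \<Rightarrow> 'a \<Rightarrow> 'v) \<Rightarrow> ('v \<Rightarrow> 'a) \<Rightarrow> bool"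
where
  "hom_LY_twisted_O_operator sA br tri \<alpha> sV \<rho> \<theta> \<beta> F G T \<longleftrightarrow>
     Vector_Spaces.linear sV sA T \<and>
     T \<circ> \<beta> = \<alpha> \<circ> T \<and>
     (\<forall>u v. br (T u) (T v) = T (\<rho> (T u) v - \<rho> (T v) u + F (T u) (T v))) \<and>
     (\<forall>u v w. tri (T u) (T v) (T w) =
        T (hom_LY_D br \<alpha> \<rho> \<theta> \<beta> (T u) (T v) w + \<theta> (T v) (T w) u - \<theta> (T u) (T w) v
           + G (T u) (T v) (T w)))"

definition induced_tri :: "('a \<Rightarrow> 'a \<Rightarrow> 'a) \<Rightarrow> ('a \<Rightarrow> 'a) \<Rightarrow> 'a \<Rightarrow> 'a \<Rightarrow> 'a \<Rightarrow> 'a" where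
  "induced_tri br \<alpha> x y z = br (br x y) (\<alpha> z)"

definition induced_theta ::
  "('a \<Rightarrow> 'a) \<Rightarrow> ('a \<Rightarrow> 'v \<Rightarrow> 'v) \<Rightarrow> 'a \<Rightarrow> 'a \<Rightarrow> 'v \<Rightarrow> 'v" where
  "induced_theta \<alpha> \<rho> x y = \<rho> (\<alpha> y) \<circ> \<rho> x"

definition induced_G ::
  "('a \<Rightarrow> 'a \<Rightarrow> 'a) \<Rightarrow> ('a \<Rightarrow> 'a) \<Rightarrow> ('a \<Rightarrow> 'v \<Rightarrow> 'v) \<Rightarrow> ('a \<Rightarrow> 'a \<Rightarrow> 'v) \<Rightarrow>
   'a \<Rightarrow> 'a \<Rightarrow> 'a \<Rightarrow> 'v::ab_group_add" where
  "induced_G br \<alpha> \<rho> F x y z = F (br x y) (\<alpha> z) - \<rho> (\<alpha> z) (F x y)"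

end

(* T is a morphism from the bracket [u,v]_T = \<rho>(Tu)v - \<rho>(Tv)u + F(Tu,Tv) on V to the bracket of A,
   and it intertwines \<beta> with \<alpha>, so it carries [[u,v]_T, \<beta> w]_T to [[Tu,Tv], \<alpha>(Tw)].  For the induced \<theta>
   the operator D(x,y) is \<rho>([x,y])\<beta>, and expanding the outer bracket of [[u,v]_T, \<beta> w]_T yields
   exactly the argument of T in the ternary condition. *)

theory Submission
  imports Defs
begin

definition twisted_O_bracket ::
  "('a \<Rightarrow> 'v \<Rightarrow> 'v) \<Rightarrow> ('a \<Rightarrow> 'a \<Rightarrow> 'v) \<Rightarrow> ('v \<Rightarrow> 'a) \<Rightarrow> 'v \<Rightarrow> 'v \<Rightarrow> 'v::ab_group_add"
where
  "twisted_O_bracket \<rho> F T u v = \<rho> (T u) v - \<rho> (T v) u + F (T u) (T v)"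

lemma twisted_O_operator_bracket:
  assumes "twisted_O_operator sA br \<alpha> sV \<rho> \<beta> F T"
  shows "br (T u) (T v) = T (twisted_O_bracket \<rho> F T u v)"
  using assms by (simp add: twisted_O_operator_def twisted_O_bracket_def)

lemma twisted_O_operator_twist:
  assumes "twisted_O_operator sA br \<alpha> sV \<rho> \<beta> F T"
  shows "\<alpha> (T u) = T (\<beta> u)"
  using assms unfolding twisted_O_operator_def by (metis comp_apply)

lemma induced_tri_hom:
  assumes "\<And>u v. br (f u) (f v) = f (br' u v)"
    and "\<And>u. \<alpha> (f u) = f (\<beta> u)"
  shows "induced_tri br \<alpha> (f u) (f v) (f w) = f (induced_tri br' \<beta> u v w)"
  by (simp add: induced_tri_def assms)

context hom_lie_representation
begin

lemma hom_LY_D_induced_theta: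
  "hom_LY_D br \<alpha> \<rho> (induced_theta \<alpha> \<rho>) \<beta> x y v = \<rho> (br x y) (\<beta> v)"
proof -
  have "induced_theta \<alpha> \<rho> y x v - induced_theta \<alpha> \<rho> x y v = \<rho> (br x y) (\<beta> v)"
    by (simp add: induced_theta_def rho_br)
  then show ?thesis
    by (simp add: hom_LY_D_def rho_br)
qed

lemma rho_twisted_O_bracket:
  "\<rho> (\<alpha> x) (twisted_O_bracket \<rho> F T u v) =
     induced_theta \<alpha> \<rho> (T u) x v - induced_theta \<alpha> \<rho> (T v) x u + \<rho> (\<alpha> x) (F (T u) (T v))"
proof -
  interpret rho: Vector_Spaces.linear sV sV "\<rho> y" for y
    using linear_rho by (simp add: bilinear_map_def)
  show ?thesis
    by (simp add: twisted_O_bracket_def induced_theta_def rho.add rho.diff)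
qed

lemma induced_tri_twisted_O_bracket:
  assumes "twisted_O_operator sA br \<alpha> sV \<rho> \<beta> F T"
  shows "induced_tri (twisted_O_bracket \<rho> F T) \<beta> u v w =
    hom_LY_D br \<alpha> \<rho> (induced_theta \<alpha> \<rho>) \<beta> (T u) (T v) w
    + induced_theta \<alpha> \<rho> (T v) (T w) u - induced_theta \<alpha> \<rho> (T u) (T w) v
    + induced_G br \<alpha> \<rho> F (T u) (T v) (T w)"
proof -
  let ?uv = "twisted_O_bracket \<rho> F T u v"
  have "induced_tri (twisted_O_bracket \<rho> F T) \<beta> u v w =
      \<rho> (T ?uv) (\<beta> w) - \<rho> (T (\<beta> w)) ?uv + F (T ?uv) (T (\<beta> w))"
    by (simp only: induced_tri_def twisted_O_bracket_def[of \<rho> F T ?uv])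
  also have "\<dots> = \<rho> (br (T u) (T v)) (\<beta> w) - \<rho> (\<alpha> (T w)) ?uv + F (br (T u) (T v)) (\<alpha> (T w))"
    by (simp only: twisted_O_operator_bracket[OF assms] twisted_O_operator_twist[OF assms])
  finally show ?thesis
    by (simp add: hom_LY_D_induced_theta rho_twisted_O_bracket induced_G_def algebra_simps)
qed

end

theorem proposition3p11:
  fixes sA :: "'k::field_char_0 \<Rightarrow> 'a::ab_group_add \<Rightarrow> 'a"
    and br :: "'a \<Rightarrow> 'a \<Rightarrow> 'a"
    and \<alpha> :: "'a \<Rightarrow> 'a"
    and sV :: "'k \<Rightarrow> 'v::ab_group_add \<Rightarrow> 'v"
    and \<rho> :: "'a \<Rightarrow> 'v \<Rightarrow> 'v"
    and \<beta> :: "'v \<Rightarrow> 'v"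
    and F :: "'a \<Rightarrow> 'a \<Rightarrow> 'v"
    and T :: "'v \<Rightarrow> 'a"
  assumes "multiplicative_hom_lie_algebra sA br \<alpha>"
    and "hom_lie_representation sA br \<alpha> sV \<rho> \<beta>"
    and "hom_lie_2_cocycle sA br \<alpha> sV \<rho> \<beta> F"
    and "twisted_O_operator sA br \<alpha> sV \<rho> \<beta> F T"
  shows "hom_LY_twisted_O_operator sA br (induced_tri br \<alpha>) \<alpha>
           sV \<rho> (induced_theta \<alpha> \<rho>) \<beta> F (induced_G br \<alpha> \<rho> F) T"
proof -
  interpret hom_lie_representation sA br \<alpha> sV \<rho> \<beta> by fact
  note twisted = \<open>twisted_O_operator sA br \<alpha> sV \<rho> \<beta> F T\<close>
  have "induced_tri br \<alpha> (T u) (T v) (T w) =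
      T (induced_tri (twisted_O_bracket \<rho> F T) \<beta> u v w)" for u v w
    using twisted_O_operator_bracket[OF twisted] twisted_O_operator_twist[OF twisted]
    by (rule induced_tri_hom)
  with twisted show ?thesis
    by (simp add: hom_LY_twisted_O_operator_def twisted_O_operator_def
        induced_tri_twisted_O_bracket[OF twisted])
qed

end
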